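(* Let $A,B\in M_2$. Suppose $$(\operatorname{tr} A)W(B)+(\operatorname{tr} B)W(A)-(\operatorname{tr} A)(\operatorname{tr} B)\subseteq W_{A}(B),$$ or equivalently $$(\operatorname{tr} A)W(B_0)+(\operatorname{tr} B)W(A_0)-\tfrac12(\operatorname{tr} A)(\operatorname{tr} B)\subseteq W_{A_0}(B_0).$$ Then $W_A(B)=W_{A\oplus 0}(B\oplus 0)$.
   Context: $M_n$ is the space of $n\times n$ complex matrices and $U_n$ the group of $n\times n$ unitary matrices. For $B\in M_n$, the classical numerical range is $W(B)=\{x^*Bx : x\in\mathbb{C}^n,\ x^*x=1\}$. For $A,B\in M_n$, the $A$-numerical range of $B$ is $W_A(B)=\{\operatorname{tr}(A\,VBV^* ) : V\in U_n\}$. For $X\in M_2$, $X_0=X-\left(\frac12\operatorname{tr}X\right)I\in M_2$, and $X\oplus 0\in M_3$ denotes the direct sum of $X$ with the $1\times 1$ zero matrix. For subsets $S,T\subseteq\mathbb{C}$ and $c\in\mathbb{C}$: $cS=\{cs: s\in S\}$, $S+T=\{s+t: s\in S,\ t\in T\}$, $S-c=\{s-c: s\in S\}$. *)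

theory Defs
  imports "HOL-Analysis.Analysis"
begin

definition ctranspose :: "complex^'n^'m \<Rightarrow> complex^'m^'n" where
  "ctranspose A = map_matrix cnj (transpose A)"

definition unitary_matrices :: "(complex^'n^'n) set" where
  "unitary_matrices = {V. V ** ctranspose V = mat 1 \<and> ctranspose V ** V = mat 1}"

(* The value of the product x^* y of a row and a column vector. *)
definition cdot :: "complex^'n \<Rightarrow> complex^'n \<Rightarrow> complex" where
  "cdot x y = (\<Sum>i\<in>UNIV. cnj (x $ i) * y $ i)"

definition numerical_range :: "complex^'n^'n \<Rightarrow> complex set" where
  "numerical_range B = {cdot x (B *v x) | x. cdot x x = 1}"

definition rel_numerical_range :: "complex^'n^'n \<Rightarrow> complex^'n^'n \<Rightarrow> complex set" where
  "rel_numerical_range A B = {trace (A ** (V ** B ** ctranspose V)) | V. V \<in> unitary_matrices}"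

(* mat c is the scalar matrix c I. *)
definition traceless_part :: "complex^2^2 \<Rightarrow> complex^2^2" where
  "traceless_part X = X - mat (trace X / 2)"

definition oplus_zero :: "complex^2^2 \<Rightarrow> complex^3^3" where
  "oplus_zero X = vector [vector [X$1$1, X$1$2, 0],
                          vector [X$2$1, X$2$2, 0],
                          vector [0,     0,     0]]"

definition set_scale :: "complex \<Rightarrow> complex set \<Rightarrow> complex set" where
  "set_scale c S = {c * s | s. s \<in> S}"

definition set_shift :: "complex set \<Rightarrow> complex \<Rightarrow> complex set" where
  "set_shift S c = {s - c | s. s \<in> S}"

(* S + T on sets is the elementwise sum of HOL-Library.Set_Algebras. *)

end

theory Submission
  imports Defs
begin

text \<open>
  Since \<open>A \<oplus> 0\<close> and \<open>B \<oplus> 0\<close> see only the upper left block \<open>C\<close> of a unitary \<open>V \<in> M\<^sub>3\<close>, the range of the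
  enlarged pair consists of the numbers \<open>trace (A C B C\<^sup>*)\<close>. Such a block has 1 as one of its singular
  values, so \<open>C = U diag(1, k) U'\<close> with \<open>U\<close>, \<open>U'\<close> unitary and \<open>\<bar>k\<bar> \<le> 1\<close>
  (\<open>upper_left_block_factorization\<close>). After absorbing \<open>U\<close>, \<open>U'\<close> into \<open>A\<close>, \<open>B\<close> and writing \<open>k = s w\<close>
  with \<open>\<bar>w\<bar> = 1\<close>, the number is \<open>a\<^sub>1\<^sub>1 b\<^sub>1\<^sub>1 + s x + s\<^sup>2 a\<^sub>2\<^sub>2 b\<^sub>2\<^sub>2\<close>. It is the convex combination, with
  weights \<open>(1 + s)\<^sup>2 / 4\<close>, \<open>(1 - s)\<^sup>2 / 4\<close> and \<open>(1 - s\<^sup>2) / 2\<close>, of the points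
  \<open>a\<^sub>1\<^sub>1 b\<^sub>1\<^sub>1 + x + a\<^sub>2\<^sub>2 b\<^sub>2\<^sub>2\<close> and \<open>a\<^sub>1\<^sub>1 b\<^sub>1\<^sub>1 - x + a\<^sub>2\<^sub>2 b\<^sub>2\<^sub>2\<close>, which lie in the range of the pair \<open>A\<close>, \<open>B\<close>,
  and \<open>a\<^sub>1\<^sub>1 b\<^sub>1\<^sub>1 - a\<^sub>2\<^sub>2 b\<^sub>2\<^sub>2\<close>, which the hypothesis puts there
  (\<open>rel_numerical_range_oplus_zero_subset\<close>).

  It remains to know that the range of a pair of \<open>2 \<times> 2\<close> matrices is convex
  (\<open>convex_rel_numerical_range_2\<close>). A translation and unitary similarities make both diagonals
  vanish; then the range is the image of the sphere \<open>\<bar>p\<bar> + \<bar>q\<bar> = 1\<close> in \<open>\<complex>\<^sup>2\<close> under a real-linear map to \<open>\<complex>\<close>.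
  That map has a nontrivial kernel, so the sphere has the same image as the ball
  (\<open>convex_linear_image_l1_sphere\<close>), and the image of the ball is convex.
\<close>

section \<open>Matrix algebra and unitary matrices\<close>

lemma ctranspose_nth [simp]: "ctranspose A $ i $ j = cnj (A $ j $ i)"
  by (simp add: ctranspose_def map_matrix_def transpose_def)

lemma ctranspose_ctranspose [simp]: "ctranspose (ctranspose A) = A"
  by (simp add: vec_eq_iff)

lemma ctranspose_mult: "ctranspose (A ** B) = ctranspose B ** ctranspose A"
  by (simp add: vec_eq_iff matrix_matrix_mult_def mult.commute)

lemma unitary_mult:
  assumes "U \<in> unitary_matrices" "V \<in> unitary_matrices"
  shows "U ** V \<in> unitary_matrices"
proof -
  have "U ** V ** (ctranspose V ** ctranspose U) = U ** (V ** ctranspose V) ** ctranspose U"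
    by (simp add: matrix_mul_assoc)
  moreover have "ctranspose V ** ctranspose U ** (U ** V) = ctranspose V ** (ctranspose U ** U) ** V"
    by (simp add: matrix_mul_assoc)
  ultimately show ?thesis
    using assms by (simp add: unitary_matrices_def ctranspose_mult)
qed

lemma unitary_ctranspose: "U \<in> unitary_matrices \<Longrightarrow> ctranspose U \<in> unitary_matrices"
  by (simp add: unitary_matrices_def)

lemma mat_1_unitary: "mat 1 \<in> unitary_matrices"
proof -
  have "ctranspose (mat 1) = (mat 1 :: complex^'n^'n)"
    by (auto simp: vec_eq_iff mat_def)
  then show ?thesis by (simp add: unitary_matrices_def)
qed

lemma unitary_conj_cancel:
  assumes "U \<in> unitary_matrices"
  shows "ctranspose U ** (U ** A ** ctranspose U) ** U = A"
proof -
  have "ctranspose U ** (U ** A ** ctranspose U) ** U = (ctranspose U ** U) ** A ** (ctranspose U ** U)"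
    by (simp add: matrix_mul_assoc)
  then show ?thesis using assms by (simp add: unitary_matrices_def)
qed

lemma trace_unitary_conj:
  assumes "U \<in> unitary_matrices"
  shows "trace (U ** A ** ctranspose U) = trace A"
  using assms trace_mul_sym [of "U ** A" "ctranspose U"]
  by (simp add: matrix_mul_assoc unitary_matrices_def)

lemma mat_mult_nth: "(mat c ** A) $ i $ j = c * A $ i $ j" for c :: complex
  by (simp add: matrix_matrix_mult_def mat_def if_distrib [of "\<lambda>x. x * _"] cong: if_cong)

lemma mult_mat_nth: "(A ** mat c) $ i $ j = A $ i $ j * c" for c :: complex
  by (simp add: matrix_matrix_mult_def mat_def if_distrib [of "\<lambda>x. _ * x"] cong: if_cong)

lemma mat_mult_commute: "mat c ** A = A ** mat c" for A :: "complex^'n^'n"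
  by (simp add: vec_eq_iff mat_mult_nth mult_mat_nth mult.commute)

lemma trace_mat_mult: "trace (mat c ** A) = c * trace A" for A :: "complex^'n^'n"
  by (simp add: trace_def mat_mult_nth sum_distrib_left)

lemma matrix_diff_mult: "(A - B) ** C = A ** C - B ** C" for A B :: "complex^'n^'m"
  by (simp add: vec_eq_iff matrix_matrix_mult_def sum_subtractf left_diff_distrib)

lemma matrix_mult_diff: "C ** (A - B) = C ** A - C ** B" for A B :: "complex^'n^'m"
  by (simp add: vec_eq_iff matrix_matrix_mult_def sum_subtractf right_diff_distrib)

text \<open>The matrix with rows \<open>(a, b)\<close> and \<open>(c, d)\<close>.\<close>

definition mat2 :: "complex \<Rightarrow> complex \<Rightarrow> complex \<Rightarrow> complex \<Rightarrow> complex^2^2" where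
  "mat2 a b c d = vector [vector [a, b], vector [c, d]]"

lemma mat2_nth [simp]:
  "mat2 a b c d $ 1 $ 1 = a" "mat2 a b c d $ 1 $ 2 = b"
  "mat2 a b c d $ 2 $ 1 = c" "mat2 a b c d $ 2 $ 2 = d"
  by (simp_all add: mat2_def)

lemma matrix_mult_2_nth:
  "(A ** B) $ i $ j = A $ i $ 1 * B $ 1 $ j + A $ i $ 2 * B $ 2 $ j" for A B :: "complex^2^2"
  by (simp add: matrix_matrix_mult_def sum_2)

lemma trace_2: "trace A = A $ 1 $ 1 + A $ 2 $ 2" for A :: "complex^2^2"
  by (simp add: trace_def sum_2)

lemma norm_squares_eq_1_iff:
  "(norm a)\<^sup>2 + (norm b)\<^sup>2 = 1 \<longleftrightarrow> a * cnj a + b * cnj b = 1" for a b :: complex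
  by (metis complex_norm_square of_real_add of_real_eq_1_iff)

lemma mat2_unitary:
  assumes "(norm a)\<^sup>2 + (norm b)\<^sup>2 = 1"
  shows "mat2 a b (- cnj b) (cnj a) \<in> unitary_matrices"
proof -
  have "a * cnj a + b * cnj b = 1"
    using assms by (simp only: norm_squares_eq_1_iff)
  then show ?thesis
    by (simp add: unitary_matrices_def vec_eq_iff forall_2 matrix_mult_2_nth mat_def algebra_simps)
qed

lemma unitary_2_entries:
  fixes V :: "complex^2^2"
  assumes "V \<in> unitary_matrices"
  shows "(norm (V $ 1 $ 1))\<^sup>2 + (norm (V $ 2 $ 1))\<^sup>2 = 1"
    and "norm (V $ 2 $ 2) = norm (V $ 1 $ 1)"
    and "norm (V $ 1 $ 2) = norm (V $ 2 $ 1)"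
proof -
  have *: "(V ** ctranspose V) $ 1 $ 1 = 1" "(ctranspose V ** V) $ 1 $ 1 = 1"
    "(ctranspose V ** V) $ 2 $ 2 = 1"
    using assms by (simp_all add: unitary_matrices_def mat_def)
  show 1: "(norm (V $ 1 $ 1))\<^sup>2 + (norm (V $ 2 $ 1))\<^sup>2 = 1"
    using *(2) by (simp add: norm_squares_eq_1_iff matrix_mult_2_nth mult.commute)
  have 2: "(norm (V $ 1 $ 1))\<^sup>2 + (norm (V $ 1 $ 2))\<^sup>2 = 1"
    using *(1) by (simp add: norm_squares_eq_1_iff matrix_mult_2_nth mult.commute)
  have 3: "(norm (V $ 1 $ 2))\<^sup>2 + (norm (V $ 2 $ 2))\<^sup>2 = 1"
    using *(3) by (simp add: norm_squares_eq_1_iff matrix_mult_2_nth mult.commute)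
  have "(norm (V $ 2 $ 2))\<^sup>2 = (norm (V $ 1 $ 1))\<^sup>2" "(norm (V $ 1 $ 2))\<^sup>2 = (norm (V $ 2 $ 1))\<^sup>2"
    using 1 2 3 by linarith+
  then show "norm (V $ 2 $ 2) = norm (V $ 1 $ 1)" "norm (V $ 1 $ 2) = norm (V $ 2 $ 1)"
    by simp_all
qed

section \<open>Unitary invariance and translation of the ranges\<close>

lemma rel_numerical_range_unitary_conj_subset:
  assumes "U \<in> unitary_matrices" "U' \<in> unitary_matrices"
  shows "rel_numerical_range (U ** A ** ctranspose U) (U' ** B ** ctranspose U')
    \<subseteq> rel_numerical_range A B"
proof
  fix z
  assume "z \<in> rel_numerical_range (U ** A ** ctranspose U) (U' ** B ** ctranspose U')"
  then obtain V where V: "V \<in> unitary_matrices"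
    and z: "z = trace (U ** A ** ctranspose U ** (V ** (U' ** B ** ctranspose U') ** ctranspose V))"
    unfolding rel_numerical_range_def by blast
  define S where "S = ctranspose U ** (V ** U')"
  have "S \<in> unitary_matrices"
    unfolding S_def by (intro unitary_mult unitary_ctranspose assms V)
  moreover have "z = trace (A ** (S ** B ** ctranspose S))"
    unfolding z S_def
    using trace_mul_sym [of U "A ** ctranspose U ** (V ** (U' ** B ** ctranspose U') ** ctranspose V)"]
    by (simp add: matrix_mul_assoc ctranspose_mult)
  ultimately show "z \<in> rel_numerical_range A B"
    unfolding rel_numerical_range_def by blast
qed

lemma rel_numerical_range_unitary_conj:
  assumes "U \<in> unitary_matrices" "U' \<in> unitary_matrices"
  shows "rel_numerical_range (U ** A ** ctranspose U) (U' ** B ** ctranspose U')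
    = rel_numerical_range A B"
proof
  show "rel_numerical_range A B
      \<subseteq> rel_numerical_range (U ** A ** ctranspose U) (U' ** B ** ctranspose U')"
    using rel_numerical_range_unitary_conj_subset [OF assms [THEN unitary_ctranspose],
        of "U ** A ** ctranspose U" "U' ** B ** ctranspose U'"]
      assms by (simp add: unitary_conj_cancel)
qed (rule rel_numerical_range_unitary_conj_subset [OF assms])

text \<open>The \<open>i\<close>-th diagonal entry of \<open>U B U\<^sup>*\<close> is the value of \<open>B\<close> at the adjoint of the \<open>i\<close>-th
  row of \<open>U\<close>, a unit vector.\<close>

lemma diagonal_in_numerical_range:
  fixes B :: "complex^'n^'n"
  assumes "U \<in> unitary_matrices"
  shows "(U ** B ** ctranspose U) $ i $ i \<in> numerical_range B"
proof -
  define x where "x = (\<chi> j. cnj (U $ i $ j))"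
  have "(U ** ctranspose U) $ i $ i = 1"
    using assms by (simp add: unitary_matrices_def mat_def)
  then have "cdot x x = 1"
    by (simp add: cdot_def x_def matrix_matrix_mult_def)
  moreover have "U ** B ** ctranspose U = U ** (B ** ctranspose U)"
    by (simp add: matrix_mul_assoc)
  then have "cdot x (B *v x) = (U ** B ** ctranspose U) $ i $ i"
    by (simp add: cdot_def x_def matrix_matrix_mult_def matrix_vector_mult_def)
  ultimately show ?thesis unfolding numerical_range_def by (auto intro!: exI [of _ x])
qed

lemma trace_mult_diff_mat:
  fixes A B V :: "complex^2^2"
  assumes V: "V \<in> unitary_matrices"
  shows "trace ((A - mat a) ** (V ** (B - mat b) ** ctranspose V))
    = trace (A ** (V ** B ** ctranspose V)) - a * trace B - b * trace A + 2 * a * b"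
proof -
  have "V ** mat b ** ctranspose V = mat b ** (V ** ctranspose V)"
    by (simp only: mat_mult_commute [of b V, symmetric] matrix_mul_assoc)
  also have "\<dots> = mat b"
    using V by (simp add: unitary_matrices_def)
  finally have "V ** mat b ** ctranspose V = mat b" .
  then have *: "V ** (B - mat b) ** ctranspose V = V ** B ** ctranspose V - mat b"
    by (simp add: matrix_diff_mult matrix_mult_diff)
  let ?C = "V ** B ** ctranspose V"
  have "trace (A ** mat b) = b * trace A"
    by (simp only: mat_mult_commute [of b A, symmetric] trace_mat_mult)
  moreover have "trace (mat b :: complex^2^2) = 2 * b"
    by (simp add: trace_def mat_def)
  moreover have "trace ?C = trace B"
    by (rule trace_unitary_conj [OF V])
  moreover have "trace ((A - mat a) ** (?C - mat b))
      = trace (A ** ?C) - trace (A ** mat b) - a * (trace ?C - trace (mat b :: complex^2^2))"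
    by (simp only: matrix_diff_mult trace_sub trace_mat_mult matrix_mult_diff)
       (simp add: trace_sub trace_mat_mult algebra_simps)
  ultimately show ?thesis
    unfolding * by (simp add: algebra_simps)
qed

lemma rel_numerical_range_traceless_part:
  "rel_numerical_range (traceless_part A) (traceless_part B)
    = set_shift (rel_numerical_range A B) (trace A * trace B / 2)"
proof -
  have "trace (traceless_part A ** (V ** traceless_part B ** ctranspose V))
      = trace (A ** (V ** B ** ctranspose V)) - trace A * trace B / 2"
    if "V \<in> unitary_matrices" for V
    unfolding traceless_part_def using that
    by (subst trace_mult_diff_mat) (simp_all add: field_simps)
  then have "(\<lambda>V. trace (traceless_part A ** (V ** traceless_part B ** ctranspose V))) ` unitary_matrices
      = (\<lambda>V. trace (A ** (V ** B ** ctranspose V)) - trace A * trace B / 2) ` unitary_matrices"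
    by (intro image_cong refl)
  then show ?thesis
    unfolding rel_numerical_range_def set_shift_def by blast
qed

lemma cdot_diff_mat_mult: "cdot x ((B - mat c) *v x) = cdot x (B *v x) - c * cdot x x"
proof -
  have "(mat c *v x) $ i = c * x $ i" for i
    by (simp add: matrix_vector_mult_def mat_def if_distrib [of "\<lambda>x. x * _"] cong: if_cong)
  then show ?thesis
    by (simp add: cdot_def matrix_vector_mult_diff_rdistrib sum_subtractf sum_distrib_left
        algebra_simps)
qed

lemma numerical_range_diff_mat:
  "numerical_range (B - mat c) = set_shift (numerical_range B) c"
proof -
  have "cdot x ((B - mat c) *v x) = cdot x (B *v x) - c" if "cdot x x = 1" for x
    using that by (simp add: cdot_diff_mat_mult)
  then have "(\<lambda>x. cdot x ((B - mat c) *v x)) ` {x. cdot x x = 1}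
      = (\<lambda>x. cdot x (B *v x) - c) ` {x. cdot x x = 1}"
    by (intro image_cong refl) simp
  then show ?thesis
    unfolding numerical_range_def set_shift_def by blast
qed

lemma set_shift_subset_iff: "set_shift S c \<subseteq> set_shift T c \<longleftrightarrow> S \<subseteq> T"
  by (auto simp: set_shift_def)

lemma mem_set_shift_iff: "x \<in> set_shift S c \<longleftrightarrow> x + c \<in> S"
  by (force simp: set_shift_def algebra_simps)

text \<open>The passage to traceless parts moves both sides of the hypothesis by the same number
  \<open>trace A * trace B / 2\<close>, which is why its two forms are equivalent.\<close>

lemma numerical_range_sum_traceless_part:
  "set_shift (set_scale (trace A) (numerical_range (traceless_part B))
          + set_scale (trace B) (numerical_range (traceless_part A)))
        (1/2 * trace A * trace B)
   = set_shift (set_shift (set_scale (trace A) (numerical_range B) + set_scale (trace B) (numerical_range A))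
        (trace A * trace B)) (trace A * trace B / 2)"
proof -
  have scale: "set_scale a (set_shift S c) = set_shift (set_scale a S) (a * c)" for a c S
  proof -
    have "set_scale a (set_shift S c) = (\<lambda>s. a * (s - c)) ` S"
      unfolding set_scale_def set_shift_def by blast
    moreover have "set_shift (set_scale a S) (a * c) = (\<lambda>s. a * s - a * c) ` S"
      unfolding set_scale_def set_shift_def by blast
    ultimately show ?thesis by (simp add: right_diff_distrib)
  qed
  have plus: "set_shift S c + set_shift T d = set_shift (S + T) (c + d)" for S T c d
  proof -
    have "set_shift S c + set_shift T d = (\<lambda>(s, t). (s - c) + (t - d)) ` (S \<times> T)"
      unfolding set_shift_def set_plus_def by auto
    moreover have "set_shift (S + T) (c + d) = (\<lambda>(s, t). s + t - (c + d)) ` (S \<times> T)"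
      unfolding set_shift_def set_plus_def by auto
    ultimately show ?thesis by (simp add: algebra_simps)
  qed
  have shift: "set_shift (set_shift S c) d = set_shift S (c + d)" for S c d
    by (auto simp: set_eq_iff mem_set_shift_iff algebra_simps)
  show ?thesis
    unfolding traceless_part_def numerical_range_diff_mat scale plus shift
    by (simp add: algebra_simps)
qed

section \<open>Linear images of a sphere in the plane\<close>

lemma linear_kernel_nontrivial:
  fixes f :: "'a::euclidean_space \<Rightarrow> 'b::euclidean_space"
  assumes "linear f" "DIM('b) < DIM('a)"
  obtains x where "x \<noteq> 0" "f x = 0"
proof -
  have "\<not> inj f"
  proof
    assume "inj f"
    then have "dim (range f) = DIM('a)"
      using dim_image_eq [OF assms(1), of UNIV] by simp
    then show False
      using dim_subset_UNIV [of "range f"] assms(2) by simp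
  qed
  then show ?thesis
    using linear_injective_0 [OF assms(1)] that by blast
qed

text \<open>The set \<open>\<bar>p\<bar> + \<bar>q\<bar> = 1\<close> is the unit sphere of a norm \<open>N\<close> on a real four-dimensional space. Its
  image in the plane equals the image of the whole unit ball, since from any point of the ball one
  can walk along the kernel of the map until the sphere is reached.\<close>

lemma convex_linear_image_l1_sphere:
  fixes f :: "complex \<times> complex \<Rightarrow> complex"
  assumes "linear f"
  shows "convex (f ` {(p, q). norm p + norm q = 1})"
proof -
  define N where "N = (\<lambda>x :: complex \<times> complex. norm (fst x) + norm (snd x))"
  have N_triangle: "N (x + y) \<le> N x + N y" for x y
    unfolding N_def using norm_triangle_ineq [of "fst x" "fst y"] norm_triangle_ineq [of "snd x" "snd y"]
    by simp
  have N_scale: "N (t *\<^sub>R x) = \<bar>t\<bar> * N x" for t x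
    by (simp add: N_def distrib_left)
  have "convex {x. N x \<le> 1}"
  proof (rule convexI)
    fix x y and u v :: real
    assume xy: "x \<in> {x. N x \<le> 1}" "y \<in> {x. N x \<le> 1}" and uv: "0 \<le> u" "0 \<le> v" "u + v = 1"
    have "N (u *\<^sub>R x + v *\<^sub>R y) \<le> u * N x + v * N y"
      using N_triangle [of "u *\<^sub>R x" "v *\<^sub>R y"] uv by (simp add: N_scale)
    also have "\<dots> \<le> u * 1 + v * 1"
      using xy uv by (intro add_mono mult_left_mono) auto
    finally show "u *\<^sub>R x + v *\<^sub>R y \<in> {x. N x \<le> 1}"
      using uv by simp
  qed
  moreover have "f ` {x. N x \<le> 1} = f ` {x. N x = 1}"
  proof
    show "f ` {x. N x \<le> 1} \<subseteq> f ` {x. N x = 1}"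
    proof
      fix z assume "z \<in> f ` {x. N x \<le> 1}"
      then obtain x where x: "N x \<le> 1" "z = f x" by blast
      obtain k where k: "k \<noteq> 0" "f k = 0"
        using linear_kernel_nontrivial [OF assms] by auto
      have Nk: "N k > 0"
        using k(1) unfolding N_def
        by (metis add_nonneg_pos add_pos_nonneg norm_ge_zero prod_eqI zero_less_norm_iff
            fst_zero snd_zero)
      \<comment> \<open>\<open>T k\<close> has norm 2, so \<open>x + T k\<close> lies outside the open unit ball.\<close>
      define T where "T = 2 / N k"
      have "T *\<^sub>R k = (x + T *\<^sub>R k) + (- 1) *\<^sub>R x" by simp
      then have "N (T *\<^sub>R k) \<le> N (x + T *\<^sub>R k) + N x"
        using N_triangle [of "x + T *\<^sub>R k" "(- 1) *\<^sub>R x"] N_scale [of "-1" x] by simp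
      moreover have "N (T *\<^sub>R k) = 2"
        using Nk by (simp add: N_scale T_def)
      ultimately have "1 \<le> N (x + T *\<^sub>R k)"
        using x by simp
      moreover have "continuous_on {0..T} (\<lambda>t. N (x + t *\<^sub>R k))"
        unfolding N_def by (intro continuous_intros)
      ultimately obtain t where "N (x + t *\<^sub>R k) = 1"
        using IVT' [of "\<lambda>t. N (x + t *\<^sub>R k)" 0 1 T] x Nk by (auto simp: T_def)
      moreover have "f (x + t *\<^sub>R k) = z"
        using assms x k by (simp add: linear_add linear_cmul)
      ultimately show "z \<in> f ` {x. N x = 1}" by blast
    qed
  qed auto
  ultimately have "convex (f ` {x. N x = 1})"
    using convex_linear_image [OF assms] by metis
  moreover have "{x. N x = 1} = {(p, q). norm p + norm q = 1}"
    by (auto simp: N_def)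
  ultimately show ?thesis by simp
qed

section \<open>Convexity for two-by-two matrices\<close>

text \<open>For zero diagonals the trace depends on \<open>V\<close> only through \<open>p = v\<^sub>1\<^sub>1 cnj v\<^sub>2\<^sub>2\<close> and
  \<open>q = v\<^sub>2\<^sub>1 cnj v\<^sub>1\<^sub>2\<close>, on which it is real-linear, and over all unitary \<open>V\<close> these pairs run through
  exactly the set \<open>\<bar>p\<bar> + \<bar>q\<bar> = 1\<close>.\<close>

lemma convex_rel_numerical_range_zero_diagonal:
  fixes A B :: "complex^2^2"
  assumes "A $ 1 $ 1 = 0" "A $ 2 $ 2 = 0" "B $ 1 $ 1 = 0" "B $ 2 $ 2 = 0"
  shows "convex (rel_numerical_range A B)"
proof -
  define a b c d where "a = A $ 1 $ 2" and "b = A $ 2 $ 1" and "c = B $ 1 $ 2" and "d = B $ 2 $ 1"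
  define f where "f = (\<lambda>(p, q). b * c * p + a * d * cnj p + a * c * q + b * d * cnj q)"
  have tr: "trace (A ** (V ** B ** ctranspose V))
      = f (V $ 1 $ 1 * cnj (V $ 2 $ 2), V $ 2 $ 1 * cnj (V $ 1 $ 2))" for V
    using assms by (simp add: trace_2 matrix_mult_2_nth f_def a_def b_def c_def d_def algebra_simps)
  have "rel_numerical_range A B = f ` {(p, q). norm p + norm q = 1}"
  proof
    show "rel_numerical_range A B \<subseteq> f ` {(p, q). norm p + norm q = 1}"
      unfolding rel_numerical_range_def
      using unitary_2_entries by (auto simp: tr norm_mult power2_eq_square intro!: imageI)
    show "f ` {(p, q). norm p + norm q = 1} \<subseteq> rel_numerical_range A B"
    proof clarify
      fix p q :: complex
      assume pq: "norm p + norm q = 1"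
      \<comment> \<open>The unitary matrix with first column \<open>(u, w)\<close> and determinant 1 gives \<open>(u\<^sup>2, - w\<^sup>2)\<close>.\<close>
      define u w where "u = csqrt p" and "w = csqrt (- q)"
      have u: "u * u = p" and w: "w * w = - q"
        by (simp_all add: u_def w_def flip: power2_eq_square)
      have norms: "(norm u)\<^sup>2 = norm p" "(norm w)\<^sup>2 = norm q"
        using u w by (metis norm_mult norm_minus_cancel power2_eq_square)+
      define S where "S = mat2 u (- cnj w) w (cnj u)"
      have "S \<in> unitary_matrices"
        using mat2_unitary [of u "- cnj w"] pq norms by (simp add: S_def)
      moreover have "f (p, q) = trace (A ** (S ** B ** ctranspose S))"
        unfolding tr using u w by (simp add: S_def)
      ultimately show "f (p, q) \<in> rel_numerical_range A B"
        unfolding rel_numerical_range_def by blast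
    qed
  qed
  moreover have "linear f"
    by (rule linearI) (auto simp: f_def scaleR_conv_of_real algebra_simps)
  ultimately show ?thesis
    by (simp add: convex_linear_image_l1_sphere)
qed

text \<open>At a unit vector the quadratic form of a traceless matrix is a real-linear function of
  \<open>r = \<bar>p\<bar>\<^sup>2 - \<bar>q\<bar>\<^sup>2\<close> and \<open>m = p cnj q\<close>, where \<open>(p, q)\<close> is the conjugate of the vector. These
  coordinates satisfy \<open>r\<^sup>2 + 4 \<bar>m\<bar>\<^sup>2 = 1\<close>, and conversely every point of this sphere comes from a unit
  vector. A real-linear map from three dimensions to two has a nontrivial zero, hence one on the
  sphere, and \<open>(p, q)\<close> becomes the first row of the unitary matrix.\<close>

lemma unitary_conj_zero_diagonal:
  fixes X :: "complex^2^2"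
  assumes "trace X = 0"
  obtains U where "U \<in> unitary_matrices"
    "(U ** X ** ctranspose U) $ 1 $ 1 = 0" "(U ** X ** ctranspose U) $ 2 $ 2 = 0"
proof -
  define z a b where "z = X $ 1 $ 1" and "a = X $ 1 $ 2" and "b = X $ 2 $ 1"
  have X22: "X $ 2 $ 2 = - z"
    using assms by (simp add: trace_2 z_def eq_neg_iff_add_eq_0 add.commute)
  define f where "f = (\<lambda>(r :: real, m). of_real r * z + a * m + b * cnj m)"
  have "linear f"
    by (rule linearI) (auto simp: f_def scaleR_conv_of_real algebra_simps)
  then obtain x where x: "x \<noteq> 0" "f x = 0"
    using linear_kernel_nontrivial by (metis DIM_complex DIM_prod DIM_real less_add_same_cancel2 zero_less_one)
  obtain r0 m0 where x_eq: "x = (r0, m0)" by fastforce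
  define s where "s = sqrt (r0\<^sup>2 + 4 * (norm m0)\<^sup>2)"
  have s: "s > 0"
    using x(1) unfolding x_eq s_def
    by (cases "m0 = 0") (auto simp: zero_prod_def add_nonneg_pos)
  define r m where "r = r0 / s" and "m = m0 / of_real s"
  have rm: "r\<^sup>2 + 4 * (norm m)\<^sup>2 = 1"
  proof -
    have "r\<^sup>2 + 4 * (norm m)\<^sup>2 = (r0\<^sup>2 + 4 * (norm m0)\<^sup>2) / s\<^sup>2"
      using s by (simp add: r_def m_def norm_divide power_divide add_divide_distrib)
    moreover have "s\<^sup>2 = r0\<^sup>2 + 4 * (norm m0)\<^sup>2"
      unfolding s_def by simp
    ultimately show ?thesis using s by (metis divide_self_if less_irrefl power_eq_0_iff)
  qed
  have fm: "of_real r * z + a * m + b * cnj m = 0"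
  proof -
    have "of_real r * z + a * m + b * cnj m = f x / of_real s"
      by (simp add: f_def x_eq r_def m_def add_divide_distrib)
    then show ?thesis using x by simp
  qed
  \<comment> \<open>For \<open>r = - 1\<close> the pair is \<open>(0, 1)\<close>; otherwise \<open>p\<close> can be taken positive.\<close>
  obtain p q :: complex where pq: "(norm p)\<^sup>2 + (norm q)\<^sup>2 = 1"
    "(norm p)\<^sup>2 - (norm q)\<^sup>2 = r" "p * cnj q = m"
  proof (cases "r = - 1")
    case True
    then have "m = 0" using rm by simp
    then show ?thesis using that [of 0 1] True by simp
  next
    case False
    have "r\<^sup>2 \<le> 1" using rm by (smt (verit) zero_le_power2)
    then have "\<bar>r\<bar> \<le> 1" by (simp add: abs_square_le_1)
    then have r: "1 + r > 0" using False by simp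
    define h where "h = sqrt ((1 + r) / 2)"
    have h: "h > 0" "h\<^sup>2 = (1 + r) / 2" using r by (simp_all add: h_def)
    have "(norm (cnj m / of_real h))\<^sup>2 = (norm m)\<^sup>2 / h\<^sup>2"
      by (simp add: norm_divide power_divide)
    also have "\<dots> = (1 - r) / 2"
      using rm r unfolding h(2) by (simp add: field_simps power2_eq_square)
    finally have n: "(norm (cnj m / of_real h))\<^sup>2 = (1 - r) / 2" .
    have "(norm (of_real h :: complex))\<^sup>2 = (1 + r) / 2"
      using h by simp
    with n h show ?thesis
      by (intro that [of "of_real h" "cnj m / of_real h"]) (simp_all add: field_simps)
  qed
  define U where "U = mat2 p q (- cnj q) (cnj p)"
  have U: "U \<in> unitary_matrices"
    unfolding U_def by (rule mat2_unitary [OF pq(1)])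
  have r: "of_real r = p * cnj p - q * cnj q"
    unfolding pq(2) [symmetric] by (simp add: complex_norm_square [symmetric])
  have 1: "(U ** X ** ctranspose U) $ 1 $ 1 = 0"
    using fm unfolding r pq(3) [symmetric]
    by (simp add: U_def matrix_mult_2_nth X22 flip: z_def a_def b_def) (simp add: algebra_simps)
  moreover have "trace (U ** X ** ctranspose U) = 0"
    using trace_unitary_conj [OF U] assms by simp
  then have "(U ** X ** ctranspose U) $ 2 $ 2 = 0"
    using 1 by (simp add: trace_2)
  ultimately show ?thesis using that U by blast
qed

lemma trace_traceless_part: "trace (traceless_part X) = 0"
  by (simp add: traceless_part_def trace_2 mat_def)

lemma convex_rel_numerical_range_2:
  fixes A B :: "complex^2^2"
  shows "convex (rel_numerical_range A B)"
proof -
  obtain U where U: "U \<in> unitary_matrices"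
    "(U ** traceless_part A ** ctranspose U) $ 1 $ 1 = 0"
    "(U ** traceless_part A ** ctranspose U) $ 2 $ 2 = 0"
    using unitary_conj_zero_diagonal [OF trace_traceless_part] by blast
  obtain V where V: "V \<in> unitary_matrices"
    "(V ** traceless_part B ** ctranspose V) $ 1 $ 1 = 0"
    "(V ** traceless_part B ** ctranspose V) $ 2 $ 2 = 0"
    using unitary_conj_zero_diagonal [OF trace_traceless_part] by blast
  have "convex (rel_numerical_range (traceless_part A) (traceless_part B))"
    using convex_rel_numerical_range_zero_diagonal [OF U(2,3) V(2,3)]
    unfolding rel_numerical_range_unitary_conj [OF U(1) V(1)] .
  moreover have "set_shift S c = (+) (- c) ` S" for S c
    unfolding set_shift_def by auto
  ultimately show ?thesis
    unfolding rel_numerical_range_traceless_part by simp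
qed

section \<open>Blocks of three-by-three unitary matrices\<close>

lemma oplus_zero_nth [simp]:
  "oplus_zero X $ 1 $ 1 = X $ 1 $ 1" "oplus_zero X $ 1 $ 2 = X $ 1 $ 2" "oplus_zero X $ 1 $ 3 = 0"
  "oplus_zero X $ 2 $ 1 = X $ 2 $ 1" "oplus_zero X $ 2 $ 2 = X $ 2 $ 2" "oplus_zero X $ 2 $ 3 = 0"
  "oplus_zero X $ 3 $ 1 = 0" "oplus_zero X $ 3 $ 2 = 0" "oplus_zero X $ 3 $ 3 = 0"
  by (simp_all add: oplus_zero_def)

text \<open>The compression of \<open>V\<close> to the first two coordinates. It is the only part of \<open>V\<close> that enters
  \<open>trace ((A \<oplus> 0) V (B \<oplus> 0) V\<^sup>*)\<close>.\<close>

definition upper_left_block :: "complex^3^3 \<Rightarrow> complex^2^2" where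
  "upper_left_block V = mat2 (V $ 1 $ 1) (V $ 1 $ 2) (V $ 2 $ 1) (V $ 2 $ 2)"

lemma matrix_mult_3_nth:
  "(A ** B) $ i $ j = A $ i $ 1 * B $ 1 $ j + A $ i $ 2 * B $ 2 $ j + A $ i $ 3 * B $ 3 $ j"
  for A B :: "complex^3^3"
  by (simp add: matrix_matrix_mult_def sum_3)

lemma trace_oplus_zero:
  "trace (oplus_zero A ** (V ** oplus_zero B ** ctranspose V))
    = trace (A ** (upper_left_block V ** B ** ctranspose (upper_left_block V)))"
  by (simp add: trace_def sum_3 sum_2 matrix_mult_3_nth matrix_mult_2_nth upper_left_block_def)

text \<open>With \<open>C\<close> the block of \<open>V\<close> and \<open>v = (v\<^sub>1\<^sub>3, v\<^sub>2\<^sub>3)\<close> the column next to it, orthonormality of the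
  rows of \<open>V\<close> says \<open>C C\<^sup>* = I - v v\<^sup>*\<close>.\<close>

lemma upper_left_block_mult_ctranspose:
  assumes "V \<in> unitary_matrices"
  shows "upper_left_block V ** ctranspose (upper_left_block V)
    = mat 1 - mat2 (V $ 1 $ 3 * cnj (V $ 1 $ 3)) (V $ 1 $ 3 * cnj (V $ 2 $ 3))
        (V $ 2 $ 3 * cnj (V $ 1 $ 3)) (V $ 2 $ 3 * cnj (V $ 2 $ 3))"
proof -
  have "(V ** ctranspose V) $ i $ j = mat 1 $ i $ j" for i j
    using assms by (simp add: unitary_matrices_def)
  from this [of 1 1] this [of 1 2] this [of 2 1] this [of 2 2] show ?thesis
    by (simp add: vec_eq_iff forall_2 matrix_mult_3_nth matrix_mult_2_nth upper_left_block_def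
        mat_def eq_diff_eq)
qed

lemma rel_numerical_range_subset_oplus_zero:
  "rel_numerical_range A B \<subseteq> rel_numerical_range (oplus_zero A) (oplus_zero B)"
proof
  fix z assume "z \<in> rel_numerical_range A B"
  then obtain V where V: "V \<in> unitary_matrices" and z: "z = trace (A ** (V ** B ** ctranspose V))"
    unfolding rel_numerical_range_def by blast
  define W :: "complex^3^3" where "W = oplus_zero V + (\<chi> i j. if i = 3 \<and> j = 3 then 1 else 0)"
  have "(V ** ctranspose V) $ i $ j = mat 1 $ i $ j" "(ctranspose V ** V) $ i $ j = mat 1 $ i $ j" for i j
    using V by (simp_all add: unitary_matrices_def)
  note * = this [of 1 1] this [of 1 2] this [of 2 1] this [of 2 2]
  have "W \<in> unitary_matrices"
    using * by (simp add: unitary_matrices_def vec_eq_iff forall_3 matrix_mult_3_nth matrix_mult_2_nth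
        W_def mat_def)
  moreover have "upper_left_block W = V"
    by (simp add: upper_left_block_def W_def vec_eq_iff forall_2)
  ultimately show "z \<in> rel_numerical_range (oplus_zero A) (oplus_zero B)"
    unfolding rel_numerical_range_def z using trace_oplus_zero [of A W B]
    by (auto intro!: exI [of _ W])
qed

lemma unitary_orthogonal_first_column:
  obtains U :: "complex^2^2" where "U \<in> unitary_matrices"
    "cnj (U $ 1 $ 1) * x + cnj (U $ 2 $ 1) * y = 0"
proof (cases "x = 0 \<and> y = 0")
  case True
  then show ?thesis using that mat_1_unitary by simp
next
  case False
  define n where "n = sqrt ((norm x)\<^sup>2 + (norm y)\<^sup>2)"
  have n: "n > 0"
    using False unfolding n_def by (auto simp: add_pos_nonneg add_nonneg_pos)
  have "(norm (- cnj y / n))\<^sup>2 + (norm (- x / n))\<^sup>2 = ((norm x)\<^sup>2 + (norm y)\<^sup>2) / n\<^sup>2"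
    by (simp add: norm_divide power_divide add_divide_distrib)
  also have "n\<^sup>2 = (norm x)\<^sup>2 + (norm y)\<^sup>2" by (simp add: n_def)
  also have "((norm x)\<^sup>2 + (norm y)\<^sup>2) / \<dots> = 1" using False
    by (simp add: sum_power2_eq_zero_iff)
  finally have "mat2 (- cnj y / n) (- x / n) (- cnj (- x / n)) (cnj (- cnj y / n)) \<in> unitary_matrices"
    by (rule mat2_unitary)
  then show ?thesis by (rule that) (simp add: field_simps)
qed

text \<open>One singular value of the block is 1, and the other is at most 1. Instead of a full singular
  value decomposition, a unitary factor \<open>U\<close> whose first column is orthogonal to \<open>(v\<^sub>1\<^sub>3, v\<^sub>2\<^sub>3)\<close> is split off. The
  rows of the remaining factor \<open>E\<close> are then orthogonal, the first a unit vector \<open>(a, b)\<close>, so that the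
  second is a multiple \<open>\<kappa> (- cnj b, cnj a)\<close>.\<close>

lemma upper_left_block_factorization:
  assumes "V \<in> unitary_matrices"
  obtains U U' \<kappa> where "U \<in> unitary_matrices" "U' \<in> unitary_matrices" "norm \<kappa> \<le> 1"
    "upper_left_block V = U ** mat2 1 0 0 \<kappa> ** U'"
proof -
  define C where "C = upper_left_block V"
  obtain U :: "complex^2^2" where U: "U \<in> unitary_matrices"
    and orth: "cnj (U $ 1 $ 1) * V $ 1 $ 3 + cnj (U $ 2 $ 1) * V $ 2 $ 3 = 0"
    by (rule unitary_orthogonal_first_column)
  define E where "E = ctranspose U ** C"
  define t where "t = cnj (U $ 1 $ 2) * V $ 1 $ 3 + cnj (U $ 2 $ 2) * V $ 2 $ 3"
  have UU: "ctranspose U ** U = mat 1" "U ** ctranspose U = mat 1"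
    using U by (simp_all add: unitary_matrices_def)
  define v w s where "v = V $ 1 $ 3" and "w = V $ 2 $ 3"
    and "s = cnj (U $ 1 $ 1) * v + cnj (U $ 2 $ 1) * w"
  define G where "G = mat2 (v * cnj v) (v * cnj w) (w * cnj v) (w * cnj w)"
  have "E ** ctranspose E = ctranspose U ** (C ** ctranspose C) ** U"
    by (simp add: E_def ctranspose_mult matrix_mul_assoc)
  also have "C ** ctranspose C = mat 1 - G"
    unfolding C_def G_def v_def w_def by (rule upper_left_block_mult_ctranspose [OF assms])
  also have "ctranspose U ** (mat 1 - G) ** U = mat 1 - ctranspose U ** G ** U"
    by (simp add: matrix_mult_diff matrix_diff_mult UU)
  also have "ctranspose U ** G ** U = mat2 (s * cnj s) (s * cnj t) (t * cnj s) (t * cnj t)"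
    by (simp add: vec_eq_iff forall_2 matrix_mult_2_nth G_def s_def t_def algebra_simps
        flip: v_def w_def)
  also have "s = 0" using orth by (simp add: s_def v_def w_def)
  finally have EE: "E ** ctranspose E = mat 1 - mat2 0 0 0 (t * cnj t)" by simp
  define a b c d where "a = E $ 1 $ 1" and "b = E $ 1 $ 2" and "c = E $ 2 $ 1" and "d = E $ 2 $ 2"
  have row1: "a * cnj a + b * cnj b = 1"
    and row12: "c * cnj a + d * cnj b = 0"
    and row2: "c * cnj c + d * cnj d = 1 - t * cnj t"
    using EE [THEN arg_cong, of "\<lambda>M. M $ 1 $ 1"] EE [THEN arg_cong, of "\<lambda>M. M $ 2 $ 1"]
      EE [THEN arg_cong, of "\<lambda>M. M $ 2 $ 2"]
    by (simp_all add: matrix_mult_2_nth mat_def a_def b_def c_def d_def)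
  have norm1: "(norm a)\<^sup>2 + (norm b)\<^sup>2 = 1"
    using row1 by (simp only: norm_squares_eq_1_iff)
  have "of_real ((norm c)\<^sup>2 + (norm d)\<^sup>2) = (of_real (1 - (norm t)\<^sup>2) :: complex)"
    using row2 by (simp only: of_real_add of_real_diff of_real_1 complex_norm_square)
  then have norm2: "(norm c)\<^sup>2 + (norm d)\<^sup>2 = 1 - (norm t)\<^sup>2"
    using of_real_eq_iff by blast
  define \<kappa> where "\<kappa> = a * d - b * c"
  define U' where "U' = mat2 a b (- cnj b) (cnj a)"
  have "U' \<in> unitary_matrices"
    unfolding U'_def by (rule mat2_unitary [OF norm1])
  moreover have kc: "- \<kappa> * cnj b = c" and kd: "\<kappa> * cnj a = d"
    using row1 row12 unfolding \<kappa>_def by algebra+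
  moreover have "norm \<kappa> \<le> 1"
  proof -
    have "(norm \<kappa>)\<^sup>2 * ((norm a)\<^sup>2 + (norm b)\<^sup>2) = (norm c)\<^sup>2 + (norm d)\<^sup>2"
      unfolding kc [symmetric] kd [symmetric] by (simp add: norm_mult power_mult_distrib algebra_simps)
    then have "(norm \<kappa>)\<^sup>2 \<le> 1" using norm1 norm2 by simp
    then show ?thesis by (simp add: power_le_one_iff abs_square_le_1)
  qed
  moreover have "E = mat2 1 0 0 \<kappa> ** U'"
    using kc kd by (simp add: vec_eq_iff forall_2 matrix_mult_2_nth U'_def a_def b_def c_def d_def)
  then have "U ** E = U ** mat2 1 0 0 \<kappa> ** U'" by (simp add: matrix_mul_assoc)
  then have "C = U ** mat2 1 0 0 \<kappa> ** U'"
    by (simp add: E_def matrix_mul_assoc UU)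
  ultimately show ?thesis using that U unfolding C_def by blast
qed

lemma trace_diag_conj:
  fixes A B :: "complex^2^2"
  shows "trace (A ** (mat2 1 0 0 k ** B ** ctranspose (mat2 1 0 0 k)))
    = A $ 1 $ 1 * B $ 1 $ 1 + (k * (A $ 1 $ 2 * B $ 2 $ 1) + cnj k * (A $ 2 $ 1 * B $ 1 $ 2))
      + k * cnj k * (A $ 2 $ 2 * B $ 2 $ 2)"
  by (simp add: trace_2 matrix_mult_2_nth algebra_simps)

section \<open>The range of the enlarged pair\<close>

text \<open>Write the block as \<open>U diag(1, k) U'\<close> with \<open>k = s w\<close>, \<open>\<bar>w\<bar> = 1\<close>, and absorb \<open>U\<close> and \<open>U'\<close> into
  \<open>A\<close> and \<open>B\<close>. The trace becomes \<open>p + s x + s\<^sup>2 q\<close>, with \<open>p\<close> and \<open>q\<close> the products of the diagonal entries.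
  The points \<open>p \<plusminus> x + q\<close> belong to the unitary matrices \<open>diag(1, \<plusminus>w)\<close>, while \<open>p - q\<close> lies in the set
  of the hypothesis, because \<open>a\<^sub>1\<^sub>1 b\<^sub>1\<^sub>1 - a\<^sub>2\<^sub>2 b\<^sub>2\<^sub>2 = trace A b\<^sub>1\<^sub>1 + trace B a\<^sub>1\<^sub>1 - trace A trace B\<close>.
  The trace is a convex combination of these three points.\<close>

lemma rel_numerical_range_oplus_zero_subset:
  fixes A B :: "complex^2^2"
  assumes "set_shift (set_scale (trace A) (numerical_range B) + set_scale (trace B) (numerical_range A))
        (trace A * trace B) \<subseteq> rel_numerical_range A B"
  shows "rel_numerical_range (oplus_zero A) (oplus_zero B) \<subseteq> rel_numerical_range A B"
proof
  fix z assume "z \<in> rel_numerical_range (oplus_zero A) (oplus_zero B)"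
  then obtain V :: "complex^3^3" where V: "V \<in> unitary_matrices"
    and z: "z = trace (A ** (upper_left_block V ** B ** ctranspose (upper_left_block V)))"
    unfolding rel_numerical_range_def trace_oplus_zero by blast
  obtain U U' k where U: "U \<in> unitary_matrices" "U' \<in> unitary_matrices" and k: "norm k \<le> 1"
    and block: "upper_left_block V = U ** mat2 1 0 0 k ** U'"
    by (rule upper_left_block_factorization [OF V])
  define A' B' where "A' = ctranspose U ** A ** U" and "B' = U' ** B ** ctranspose U'"
  have W: "rel_numerical_range A' B' = rel_numerical_range A B"
    using rel_numerical_range_unitary_conj [OF unitary_ctranspose [OF U(1)] U(2), of A B]
    by (simp add: A'_def B'_def)
  have z': "z = trace (A' ** (mat2 1 0 0 k ** B' ** ctranspose (mat2 1 0 0 k)))"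
    unfolding z block A'_def B'_def
    using trace_mul_sym [of "ctranspose U" "A ** U ** (mat2 1 0 0 k ** (U' ** B ** ctranspose U')
      ** ctranspose (mat2 1 0 0 k))"]
    by (simp add: matrix_mul_assoc ctranspose_mult)
  define s where "s = norm k"
  obtain w where w: "norm w = 1" "k = of_real s * w"
  proof (cases "k = 0")
    case True
    then show ?thesis using that [of 1] by (simp add: s_def)
  next
    case False
    then show ?thesis using that [of "sgn k"]
      by (simp add: s_def sgn_eq norm_divide)
  qed
  have ww: "w * cnj w = 1"
    using w(1) by (simp add: complex_norm_square [symmetric])
  define p q x where "p = A' $ 1 $ 1 * B' $ 1 $ 1" and "q = A' $ 2 $ 2 * B' $ 2 $ 2"
    and "x = w * (A' $ 1 $ 2 * B' $ 2 $ 1) + cnj w * (A' $ 2 $ 1 * B' $ 1 $ 2)"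
  have mem: "p + of_real e * x + q \<in> rel_numerical_range A B" if "e = 1 \<or> e = -1" for e :: real
  proof -
    define D where "D = mat2 1 0 0 (of_real e * w)"
    have e: "of_real e * of_real e = (1 :: complex)" using that by auto
    have "D \<in> unitary_matrices"
    proof -
      have "of_real e * w * (of_real e * cnj w) = 1" using e ww by algebra
      then show ?thesis
        by (simp add: unitary_matrices_def vec_eq_iff forall_2 matrix_mult_2_nth mat_def D_def
            mult.commute)
    qed
    moreover have "trace (A' ** (D ** B' ** ctranspose D)) = p + of_real e * x + q"
    proof -
      have "of_real e * w * cnj (of_real e * w) = 1" using e ww by simp algebra
      then show ?thesis
        unfolding D_def trace_diag_conj p_def q_def x_def by (simp add: algebra_simps)
    qed
    ultimately show ?thesis
      unfolding W [symmetric] unfolding rel_numerical_range_def by (auto intro!: exI [of _ D])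
  qed
  have mem0: "p - q \<in> rel_numerical_range A B"
  proof -
    have "A' $ 1 $ 1 \<in> numerical_range A" "B' $ 1 $ 1 \<in> numerical_range B"
      using diagonal_in_numerical_range [OF unitary_ctranspose [OF U(1)], of A 1]
        diagonal_in_numerical_range [OF U(2), of B 1]
      by (simp_all add: A'_def B'_def)
    then have "trace A * B' $ 1 $ 1 + trace B * A' $ 1 $ 1 - trace A * trace B \<in> rel_numerical_range A B"
      using assms unfolding set_shift_def set_scale_def set_plus_def by blast
    moreover have "trace A = A' $ 1 $ 1 + A' $ 2 $ 2" "trace B = B' $ 1 $ 1 + B' $ 2 $ 2"
      using trace_unitary_conj [OF unitary_ctranspose [OF U(1)], of A]
        trace_unitary_conj [OF U(2), of B]
      by (simp_all add: A'_def B'_def trace_2)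
    ultimately show ?thesis
      by (simp add: p_def q_def algebra_simps)
  qed
  have s: "0 \<le> s" "s\<^sup>2 \<le> 1"
    using k by (simp_all add: s_def power_le_one)
  \<comment> \<open>The weights solve \<open>\<alpha> + \<beta> + \<gamma> = 1\<close>, \<open>\<alpha> - \<beta> = s\<close>, \<open>\<alpha> + \<beta> - \<gamma> = s\<^sup>2\<close>.\<close>
  define \<alpha> \<beta> \<gamma> where "\<alpha> = (1 + s)\<^sup>2 / 4" and "\<beta> = (1 - s)\<^sup>2 / 4" and "\<gamma> = (1 - s\<^sup>2) / 2"
  have "z = \<alpha> *\<^sub>R (p + x + q) + \<beta> *\<^sub>R (p - x + q) + \<gamma> *\<^sub>R (p - q)"
  proof -
    have "z = p + of_real s * x + of_real (s\<^sup>2) * q"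
    proof -
      have "k * cnj k = of_real (s\<^sup>2)" unfolding s_def by (simp only: complex_norm_square)
      moreover have "k * (A' $ 1 $ 2 * B' $ 2 $ 1) + cnj k * (A' $ 2 $ 1 * B' $ 1 $ 2) = of_real s * x"
        by (simp add: w(2) x_def distrib_left mult.assoc)
      ultimately show ?thesis
        unfolding z' trace_diag_conj p_def q_def by (simp only:)
    qed
    also have "\<dots> = of_real (\<alpha> + \<beta> + \<gamma>) * p + of_real (\<alpha> - \<beta>) * x + of_real (\<alpha> + \<beta> - \<gamma>) * q"
    proof -
      have "\<alpha> + \<beta> + \<gamma> = 1" "\<alpha> - \<beta> = s" "\<alpha> + \<beta> - \<gamma> = s\<^sup>2"
        by (simp_all add: \<alpha>_def \<beta>_def \<gamma>_def power2_eq_square field_simps)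
      then show ?thesis by simp
    qed
    finally show ?thesis by (simp add: scaleR_conv_of_real algebra_simps)
  qed
  moreover have "\<alpha> *\<^sub>R (p + x + q) + \<beta> *\<^sub>R (p - x + q) + \<gamma> *\<^sub>R (p - q)
      \<in> convex hull {p + x + q, p - x + q, p - q}"
  proof -
    have "0 \<le> \<alpha>" "0 \<le> \<beta>" "0 \<le> \<gamma>"
      using s by (simp_all add: \<alpha>_def \<beta>_def \<gamma>_def)
    moreover have "\<alpha> + \<beta> + \<gamma> = 1"
      by (simp add: \<alpha>_def \<beta>_def \<gamma>_def power2_eq_square field_simps)
    ultimately show ?thesis unfolding convex_hull_3 by blast
  qed
  moreover have "convex hull {p + x + q, p - x + q, p - q} \<subseteq> rel_numerical_range A B"
    using mem [of 1] mem [of "-1"] mem0 by (intro hull_minimal convex_rel_numerical_range_2) simp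
  ultimately show "z \<in> rel_numerical_range A B" by auto
qed

theorem theorem7:
  fixes A B :: "complex^2^2"
  shows
    "(set_shift (set_scale (trace A) (numerical_range B) + set_scale (trace B) (numerical_range A))
        (trace A * trace B) \<subseteq> rel_numerical_range A B
      \<longleftrightarrow>
      set_shift (set_scale (trace A) (numerical_range (traceless_part B))
          + set_scale (trace B) (numerical_range (traceless_part A)))
        (1/2 * trace A * trace B) \<subseteq> rel_numerical_range (traceless_part A) (traceless_part B))
     \<and>
     (set_shift (set_scale (trace A) (numerical_range B) + set_scale (trace B) (numerical_range A))
        (trace A * trace B) \<subseteq> rel_numerical_range A B
      \<longrightarrow>
      rel_numerical_range A B = rel_numerical_range (oplus_zero A) (oplus_zero B))"
  unfolding numerical_range_sum_traceless_part rel_numerical_range_traceless_part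
    set_shift_subset_iff
  using rel_numerical_range_subset_oplus_zero rel_numerical_range_oplus_zero_subset by blast

end
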